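(* For a typical function $f \in C[0,1]$, we have $$\limsup_{|\xi| \to \infty} |\widehat{\mu}(\xi)| \geq \frac{1}{5}$$ for every Borel probability measure $\mu$ supported on the graph $G_f := \{(x,f(x)) : x \in [0,1]\} \subset \mathbb{R}^2$. In particular, for a typical function $f \in C[0,1]$ the Fourier dimension satisfies $\dim_{\mathrm{F}} G_f = 0$.
   Context: $C[0,1]$ is the complete metric space of continuous functions $f:[0,1]\to\mathbb{R}$ with the sup-norm $\|\cdot\|_\infty$. In a complete metric space $X$, a set is meagre if it is a countable union of nowhere dense sets, and residual if its complement is meagre. A property holds for a typical $f \in X$ if the set of points of $X$ having the property is residual. For a Borel probability measure $\mu$ on $\mathbb{R}^2$, $\widehat{\mu}(\xi) := \int_{\mathbb{R}^2} e^{-2\pi i x\cdot \xi}\, d\mu(x)$, $\xi \in \mathbb{R}^2$. For $K \subset \mathbb{R}^2$, $\mathcal{P}(K)$ is the family of all Borel probability measures supported on $K$ (i.e. $\operatorname{spt}\mu\subset K$), and the Fourier dimension of $K$ is $$\dim_{\mathrm{F}} K := \sup\{0 \leq s \leq 2 : \text{there exist } \mu \in \mathcal{P}(K) \text{ and a constant } C>0 \text{ such that } |\widehat{\mu}(\xi)| \leq C|\xi|^{-s/2} \text{ for all } \xi \in \mathbb{R}^2\setminus\{0\}\}.$$ *)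

theory Defs
  imports "HOL-Probability.Probability"
begin

subsection \<open>Baire category\<close>

definition nowhere_dense_in :: "'a topology \<Rightarrow> 'a set \<Rightarrow> bool" where
  "nowhere_dense_in X S \<longleftrightarrow> S \<subseteq> topspace X \<and> X interior_of (X closure_of S) = {}"

definition meagre_in :: "'a topology \<Rightarrow> 'a set \<Rightarrow> bool" where
  "meagre_in X S \<longleftrightarrow>
     (\<exists>\<F>. countable \<F> \<and> (\<forall>T\<in>\<F>. nowhere_dense_in X T) \<and> S = \<Union>\<F>)"

definition residual_in :: "'a topology \<Rightarrow> 'a set \<Rightarrow> bool" where
  "residual_in X S \<longleftrightarrow> S \<subseteq> topspace X \<and> meagre_in X (topspace X - S)"

definition typical_in :: "'a metric \<Rightarrow> ('a \<Rightarrow> bool) \<Rightarrow> bool" where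
  "typical_in m P \<longleftrightarrow> residual_in (mtopology_of m) {x \<in> mspace m. P x}"

subsection \<open>The space of continuous functions on the unit interval\<close>

text \<open>The points of this metric space are the real functions that are continuous on the unit
  interval, normalised to be \<^const>\<open>undefined\<close> outside it; the metric is the
  supremum of the pointwise distances over the interval.\<close>

definition C01 :: "(real \<Rightarrow> real) metric" where
  "C01 = cfunspace (top_of_set {0..1}) euclidean_metric"

lemma mspace_C01: "mspace C01 = {f \<in> extensional {0..1}. continuous_on {0..1} f}"
proof -
  have "Met_TC.mbounded (f ` {0..1})"
    if "continuous_on {0..1} f" for f :: "real \<Rightarrow> real"
    using that by (simp add: compact_continuous_image compact_imp_bounded)
  then show ?thesis
    by (auto simp: C01_def)
qed

lemma mdist_C01:
  assumes "f \<in> mspace C01" "g \<in> mspace C01"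
  shows "mdist C01 f g = (SUP x\<in>{0..1}. \<bar>f x - g x\<bar>)"
proof -
  have "f \<in> Met_TC.fspace {0..1}" "g \<in> Met_TC.fspace {0..1}"
    using assms by (auto simp: C01_def Met_TC.fspace_def)
  then show ?thesis
    by (simp add: C01_def mdist_cfunspace_eq_mdist_funspace Met_TC.fdist_def dist_real_def)
qed

lemma mcomplete_C01: "mcomplete_of C01"
  using Met_TC.mcomplete_cfunspace[where ?'a = real, of "top_of_set {0..1::real}"]
  by (simp add: C01_def Met_TC.Self_def euclidean_metric_def complete_UNIV)

definition graph01 :: "(real \<Rightarrow> real) \<Rightarrow> (real \<times> real) set" where
  "graph01 f = {(x, f x) | x. x \<in> {0..1}}"

subsection \<open>Fourier transforms of measures and the Fourier dimension\<close>

definition spt :: "'a::topological_space measure \<Rightarrow> 'a set" where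
  "spt M = {x. \<forall>U. open U \<longrightarrow> x \<in> U \<longrightarrow> emeasure M U > 0}"

definition borel_prob_measures_on :: "'a::topological_space set \<Rightarrow> 'a measure set" where
  "borel_prob_measures_on K = {M. prob_space M \<and> sets M = sets borel \<and> spt M \<subseteq> K}"

definition fourier_transform :: "(real \<times> real) measure \<Rightarrow> real \<times> real \<Rightarrow> complex" where
  "fourier_transform M \<xi> =
     (\<integral>x. exp (- 2 * complex_of_real pi * \<i> * complex_of_real (x \<bullet> \<xi>)) \<partial>M)"

text \<open>For nonempty \<open>K\<close> the set below contains \<open>0\<close> (take a point mass) and is
  bounded by \<open>2\<close>, so its supremum is genuine; for empty \<open>K\<close> the set is empty and the
  value is the conventional real supremum of the empty set.\<close>

definition fourier_dim :: "(real \<times> real) set \<Rightarrow> real" where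
  "fourier_dim K = Sup {s. 0 \<le> s \<and> s \<le> 2 \<and>
     (\<exists>M\<in>borel_prob_measures_on K. \<exists>C>0. \<forall>\<xi>. \<xi> \<noteq> 0 \<longrightarrow>
        norm (fourier_transform M \<xi>) \<le> C * norm \<xi> powr (- s / 2))}"

end

(* Let u = e(M x) and v = e(N f(x)) on the graph of f, for integers M, N. If f is close to a step
   function with values in (1/N)Z whose transitions take place near the points of (1/M)Z, then
   everywhere on the graph u or v is close to 1, so (1 - u)(1 - v) is uniformly at most a small c.
   Integrating against mu gives |1 - mu^(M,0) - mu^(0,N) + mu^(M,N)| <= c, hence one of these three
   Fourier coefficients has modulus at least (1 - c)/3, which is 1/5 for c = 2/5. For each n,
   the functions f that admit such M, N >= n contain a dense open set. *)
theory Submission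
  imports Defs
begin

section \<open>Supports of measures and characters of the plane\<close>

text \<open>Every point off the support has a null open neighbourhood, which contains a null basis
  set around that point. A countable basis has only countably many null members, so their union is
  null. This turns \<open>spt \<mu> \<subseteq> graph01 f\<close> into an almost-everywhere
  statement that can be integrated.\<close>

lemma AE_in_spt:
  fixes M :: "'a::second_countable_topology measure"
  assumes "sets M = sets borel"
  shows "AE x in M. x \<in> spt M"
proof -
  obtain B :: "'a set set" where B: "countable B" "topological_basis B"
    using ex_countable_basis by blast
  define N where "N = {U \<in> B. emeasure M U = 0}"
  have "\<Union>N \<in> null_sets M"
  proof -
    have "(\<Union>U\<in>N. U) \<in> null_sets M"
    proof (rule null_sets_UN')
      show "countable N"
        using B(1) by (auto simp: N_def)
      fix U assume "U \<in> N"
      then show "U \<in> null_sets M"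
        using B(2) assms by (auto simp: N_def null_sets_def topological_basis_open)
    qed
    then show ?thesis by simp
  qed
  moreover have "{x \<in> space M. x \<notin> spt M} \<subseteq> \<Union>N"
  proof
    fix x assume "x \<in> {x \<in> space M. x \<notin> spt M}"
    then obtain U where U: "open U" "x \<in> U" "emeasure M U = 0"
      by (auto simp: spt_def)
    then obtain V where V: "V \<in> B" "x \<in> V" "V \<subseteq> U"
      using B(2) topological_basisE by metis
    have "emeasure M V \<le> emeasure M U"
      using U V assms by (intro emeasure_mono) auto
    then show "x \<in> \<Union>N"
      using U V by (auto simp: N_def)
  qed
  ultimately show ?thesis
    by (rule AE_I')
qed

text \<open>A chord of the unit circle is no longer than the arc it spans.\<close>

lemma norm_cis_diff_le: "norm (cis a - cis b) \<le> \<bar>a - b\<bar>"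
proof -
  have "cis a - cis b = cis b * (cis (a - b) - 1)"
    by (simp add: right_diff_distrib cis_mult)
  then have "norm (cis a - cis b) = norm (exp (\<i> * of_real (a - b)) - 1)"
    by (simp add: norm_mult cis_conv_exp)
  also have "\<dots> = 2 * \<bar>sin ((a - b) / 2)\<bar>"
    by (simp only: dist_exp_i_1)
  also have "\<dots> \<le> \<bar>a - b\<bar>"
    using abs_sin_x_le_abs_x[of "(a - b) / 2"] by simp
  finally show ?thesis .
qed

lemma fourier_transform_Pair:
  "fourier_transform M (a, b) = (\<integral>z. cis (- 2 * pi * a * fst z) * cis (- 2 * pi * b * snd z) \<partial>M)"
  unfolding fourier_transform_def
proof (rule Bochner_Integration.integral_cong)
  fix z :: "real \<times> real"
  have "exp (- 2 * complex_of_real pi * \<i> * complex_of_real (z \<bullet> (a, b)))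
      = cis (- 2 * pi * a * fst z + - 2 * pi * b * snd z)"
    by (cases z) (simp add: cis_conv_exp algebra_simps)
  then show "exp (- 2 * complex_of_real pi * \<i> * complex_of_real (z \<bullet> (a, b)))
      = cis (- 2 * pi * a * fst z) * cis (- 2 * pi * b * snd z)"
    by (simp add: cis_mult)
qed simp

section \<open>Resonance and Fourier coefficients\<close>

text \<open>The product of the two factors is bounded rather than their minimum, because the product
  is what gets integrated. Each factor is at most 2, so at each point it is enough that one of them
  be small.\<close>

definition resonant :: "real \<Rightarrow> (real \<Rightarrow> real) \<Rightarrow> nat \<Rightarrow> nat \<Rightarrow> bool" where
  "resonant c f M N \<longleftrightarrow> (\<forall>x\<in>{0..1}.
     norm (1 - cis (- 2 * pi * M * x)) * norm (1 - cis (- 2 * pi * N * f x)) \<le> c)"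

text \<open>Expanding \<open>(1 - u) * (1 - v)\<close> and integrating term by term produces exactly
  the three Fourier coefficients. Their alternating sum with 1 has modulus at most \<open>c\<close>,
  so together they must nearly cancel the 1.\<close>

lemma resonant_fourier_transform_ge:
  assumes \<mu>: "\<mu> \<in> borel_prob_measures_on (graph01 f)" and res: "resonant c f M N"
  shows "1 - c \<le> norm (fourier_transform \<mu> (M, 0)) + norm (fourier_transform \<mu> (0, N))
                + norm (fourier_transform \<mu> (M, N))"
proof -
  have pr: "prob_space \<mu>" and sets: "sets \<mu> = sets borel" and spt: "spt \<mu> \<subseteq> graph01 f"
    using \<mu> by (auto simp: borel_prob_measures_on_def)
  interpret prob_space \<mu> by fact
  note [measurable_cong] = sets
  define u :: "real \<times> real \<Rightarrow> complex" where "u = (\<lambda>z. cis (- 2 * pi * M * fst z))"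
  define v :: "real \<times> real \<Rightarrow> complex" where "v = (\<lambda>z. cis (- 2 * pi * N * snd z))"
  have meas: "u \<in> borel_measurable borel" "v \<in> borel_measurable borel"
    unfolding u_def v_def
    by (intro borel_measurable_continuous_onI continuous_intros)+
  have [measurable]: "u \<in> borel_measurable \<mu>" "v \<in> borel_measurable \<mu>"
    using meas measurable_cong_sets[OF sets refl] by auto
  have norm_uv: "norm (u z) = 1" "norm (v z) = 1" for z
    by (simp_all add: u_def v_def)
  have int: "integrable \<mu> u" "integrable \<mu> v" "integrable \<mu> (\<lambda>z. u z * v z)"
    using norm_uv by (auto intro!: integrable_const_bound[where B = 1] simp: norm_mult)
  have AE: "AE z in \<mu>. norm ((1 - u z) * (1 - v z)) \<le> c"
    using AE_in_spt[OF sets]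
  proof eventually_elim
    fix z assume "z \<in> spt \<mu>"
    then obtain x where "x \<in> {0..1}" "z = (x, f x)"
      using spt by (auto simp: graph01_def)
    then show "norm ((1 - u z) * (1 - v z)) \<le> c"
      using res by (auto simp: resonant_def u_def v_def norm_mult)
  qed
  \<comment> \<open>A function bounded almost everywhere is integrable on a probability
    space.\<close>
  have int': "integrable \<mu> (\<lambda>z. (1 - u z) * (1 - v z))"
    by (rule integrable_const_bound[where B = c, OF AE]) simp
  have "norm (\<integral>z. (1 - u z) * (1 - v z) \<partial>\<mu>) \<le> (\<integral>z. norm ((1 - u z) * (1 - v z)) \<partial>\<mu>)"
    by (rule integral_norm_bound)
  also have "\<dots> \<le> (\<integral>z. c \<partial>\<mu>)"
    by (rule integral_mono_AE) (use AE int' in auto)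
  also have "\<dots> = c"
    by (simp add: prob_space)
  finally have le: "norm (\<integral>z. (1 - u z) * (1 - v z) \<partial>\<mu>) \<le> c" .
  have "(\<integral>z. (1 - u z) * (1 - v z) \<partial>\<mu>) = (\<integral>z. 1 - u z - v z + u z * v z \<partial>\<mu>)"
    by (simp add: algebra_simps)
  also have "\<dots> = 1 - (\<integral>z. u z \<partial>\<mu>) - (\<integral>z. v z \<partial>\<mu>) + (\<integral>z. u z * v z \<partial>\<mu>)"
    using int by (simp add: prob_space)
  also have "(\<integral>z. u z \<partial>\<mu>) = fourier_transform \<mu> (M, 0)"
    by (simp add: fourier_transform_Pair u_def)
  also have "(\<integral>z. v z \<partial>\<mu>) = fourier_transform \<mu> (0, N)"
    by (simp add: fourier_transform_Pair v_def)
  also have "(\<integral>z. u z * v z \<partial>\<mu>) = fourier_transform \<mu> (M, N)"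
    by (simp add: fourier_transform_Pair u_def v_def)
  finally have eq: "(\<integral>z. (1 - u z) * (1 - v z) \<partial>\<mu>)
    = 1 - fourier_transform \<mu> (M, 0) - fourier_transform \<mu> (0, N) + fourier_transform \<mu> (M, N)" .
  \<comment> \<open>From \<open>1 = (1 - a - b + d) + a + b - d\<close>.\<close>
  have tri: "1 \<le> norm (1 - a - b + d) + norm a + norm b + norm d" for a b d :: complex
    using norm_triangle_ineq4[of "1 - a - b + d" d] norm_triangle_ineq[of "1 - a - b" b]
      norm_triangle_ineq[of "1 - a" a] by simp
  show ?thesis
    using le tri unfolding eq
    by (smt (verit))
qed

text \<open>Moving the function by \<open>d\<close> moves the second factor by at most
  \<open>2 * pi * N * d\<close>, while the first is at most 2. The loss grows with \<open>N\<close>,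
  so the admissible distance has to be chosen after \<open>N\<close>.\<close>

lemma resonant_perturb:
  assumes "resonant c g M N" and "\<And>x. x \<in> {0..1} \<Longrightarrow> \<bar>f x - g x\<bar> \<le> d"
  shows "resonant (c + 4 * pi * N * d) f M N"
  unfolding resonant_def
proof
  fix x :: real assume x: "x \<in> {0..1}"
  let ?p = "norm (1 - cis (- 2 * pi * M * x))"
  have p: "?p \<le> 2"
    using norm_triangle_ineq4[of 1 "cis (- 2 * pi * M * x)"] by simp
  have "norm (cis (- 2 * pi * N * g x) - cis (- 2 * pi * N * f x))
      \<le> \<bar>- 2 * pi * N * g x - - 2 * pi * N * f x\<bar>"
    by (rule norm_cis_diff_le)
  also have "\<dots> = 2 * pi * N * \<bar>f x - g x\<bar>"
  proof -
    have "- 2 * pi * N * g x - - 2 * pi * N * f x = 2 * pi * N * (f x - g x)"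
      by (simp add: algebra_simps)
    then show ?thesis by (simp add: abs_mult)
  qed
  also have "\<dots> \<le> 2 * pi * N * d"
    using assms(2)[OF x] by (intro mult_left_mono) auto
  finally have "norm (cis (- 2 * pi * N * g x) - cis (- 2 * pi * N * f x)) \<le> 2 * pi * N * d" .
  then have q: "norm (1 - cis (- 2 * pi * N * f x))
      \<le> norm (1 - cis (- 2 * pi * N * g x)) + 2 * pi * N * d"
    using norm_triangle_ineq[of "1 - cis (- 2 * pi * N * g x)"
      "cis (- 2 * pi * N * g x) - cis (- 2 * pi * N * f x)"] by simp
  have d: "0 \<le> 2 * pi * N * d"
    using assms(2)[OF x] by simp
  have "?p * norm (1 - cis (- 2 * pi * N * f x))
      \<le> ?p * norm (1 - cis (- 2 * pi * N * g x)) + ?p * (2 * pi * N * d)"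
    using mult_left_mono[OF q, of ?p] by (simp add: distrib_left)
  also have "\<dots> \<le> c + 2 * (2 * pi * N * d)"
    using assms(1) x p d by (intro add_mono mult_right_mono) (auto simp: resonant_def)
  finally show "?p * norm (1 - cis (- 2 * pi * N * f x)) \<le> c + 4 * pi * N * d"
    by (simp add: algebra_simps)
qed

section \<open>Density of resonant functions\<close>

text \<open>Replace \<open>f\<close> by a step function with values in \<open>(1/N)Z\<close> and
  jumps in \<open>(1/M)Z\<close>, then blend back to \<open>f\<close> near the jumps. Away from the
  jumps the second factor vanishes; near them the first one is small.\<close>

lemma resonant_dense:
  assumes f: "continuous_on {0..1} f" and \<delta>: "\<delta> > 0" and c: "c > 0"
  shows "\<exists>g M N. continuous_on {0..1} g \<and> (\<forall>x\<in>{0..1}. \<bar>g x - f x\<bar> \<le> \<delta>) \<and>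
           n \<le> M \<and> n \<le> N \<and> resonant c g M N"
proof -
  have "uniformly_continuous_on {0..1} f"
    using f by (simp add: compact_uniformly_continuous)
  then obtain \<eta> where \<eta>: "\<eta> > 0"
    "\<And>x y. x \<in> {0..1} \<Longrightarrow> y \<in> {0..1} \<Longrightarrow> dist y x < \<eta> \<Longrightarrow> dist (f y) (f x) < \<delta> / 2"
    using \<delta> unfolding uniformly_continuous_on_def by (metis half_gt_zero)
  \<comment> \<open>\<open>N\<close> controls the rounding error of the values and \<open>M\<close>
    the oscillation of \<open>f\<close> on a cell of length \<open>1 / M\<close>; each gets half of
    \<delta>. The \<open>Suc\<close> below makes both positive.\<close>
  obtain N0 :: nat where N0: "1 / (\<delta> / 2) < N0" using reals_Archimedean2 by blast
  obtain M0 :: nat where M0: "1 / \<eta> < M0" using reals_Archimedean2 by blast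
  define N where "N = max n (Suc N0)"
  define M where "M = max n (Suc M0)"
  have N: "n \<le> N" "0 < N" "1 / N < \<delta> / 2"
  proof -
    have "1 / (\<delta> / 2) < N" using N0 by (simp add: N_def)
    then show "1 / N < \<delta> / 2" using \<delta> by (simp add: N_def field_simps)
  qed (auto simp: N_def)
  have M: "n \<le> M" "0 < M" "1 / M < \<eta>"
  proof -
    have "1 / \<eta> < M" using M0 by (simp add: M_def)
    then show "1 / M < \<eta>" using \<eta> by (simp add: M_def field_simps)
  qed (auto simp: M_def)
  define p where "p x = norm (1 - cis (- 2 * pi * M * x))" for x :: real
  \<comment> \<open>A continuous cutoff, affine in \<open>p\<close> between its values 1 for
    \<open>p x \<le> c / 4\<close> and 0 for \<open>p x \<ge> c / 2\<close>.\<close>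
  define w where "w x = max 0 (min 1 (2 - 4 * p x / c))" for x :: real
  \<comment> \<open>The value of \<open>f\<close> at the left end of the cell number
    \<open>k\<close>, rounded to a multiple of \<open>1 / N\<close>.\<close>
  define h where "h k = of_int (round (N * f (of_int k / M))) / real N" for k :: int
  \<comment> \<open>The jumps of the step part lie in \<open>(1/M)\<int>\<close>, where \<open>p = 0\<close> and hence \<open>w = 1\<close> nearby:
    they are switched off, so \<open>g\<close> is continuous.\<close>
  define g where "g x = w x * f x + (1 - w x) * h \<lfloor>M * x\<rfloor>" for x :: real
  have w: "0 \<le> w x" "w x \<le> 1" for x by (auto simp: w_def)
  have w1: "w x = 1" if "p x < c / 4" for x
    using that c by (simp add: w_def field_simps)
  have w0: "w x = 0" if "c / 2 \<le> p x" for x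
    using that c by (simp add: w_def field_simps)
  have cont_p: "continuous_on UNIV p"
    unfolding p_def by (intro continuous_intros)
  have cont_w: "continuous_on UNIV w"
    unfolding w_def by (intro continuous_intros cont_p) (use c in auto)
  have "continuous (at x within {0..1}) g" if x: "x \<in> {0..1}" for x :: real
  proof (cases "M * x \<in> \<int>")
    case True
    then obtain k where k: "M * x = of_int k" by (elim Ints_cases)
    have "- 2 * pi * M * x = 2 * pi * of_int (- k)"
      using k by simp
    then have "cis (- 2 * pi * M * x) = 1"
      by (metis cis_multiple_2pi Ints_of_int)
    then have "p x < c / 4"
      using c by (simp add: p_def)
    moreover have "(p \<longlongrightarrow> p x) (at x within {0..1})"
      using cont_p by (metis UNIV_I at_within_open continuous_on_def open_UNIV tendsto_within_subset subset_UNIV)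
    ultimately have "eventually (\<lambda>y. p y < c / 4) (at x within {0..1})"
      by (metis order_tendstoD(2))
    then have ev: "eventually (\<lambda>y. f y = g y) (at x within {0..1})"
      by eventually_elim (simp add: g_def w1)
    have "g x = f x"
      using \<open>p x < c / 4\<close> by (simp add: g_def w1)
    moreover have "(f \<longlongrightarrow> f x) (at x within {0..1})"
      using f x by (auto simp: continuous_on_def)
    ultimately show ?thesis
      using ev unfolding continuous_within by (simp add: tendsto_cong[OF ev])
  next
    \<comment> \<open>Off \<open>(1/M)Z\<close> the floor is locally constant, so near
      \<open>x\<close> the value of \<open>h\<close> can be frozen.\<close>
    case False
    have "((\<lambda>y. M * y) \<longlongrightarrow> M * x) (at x within {0..1})"
      by (intro tendsto_intros)
    then have ev: "eventually (\<lambda>y. \<lfloor>M * y\<rfloor> = \<lfloor>M * x\<rfloor>) (at x within {0..1})"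
      using False by (rule eventually_floor_eq)
    have ev: "eventually (\<lambda>y. w y * f y + (1 - w y) * h \<lfloor>M * x\<rfloor> = g y) (at x within {0..1})"
      using ev by eventually_elim (simp add: g_def)
    have "(w \<longlongrightarrow> w x) (at x within {0..1})"
      using cont_w by (metis UNIV_I at_within_open continuous_on_def open_UNIV tendsto_within_subset subset_UNIV)
    moreover have "(f \<longlongrightarrow> f x) (at x within {0..1})"
      using f x by (auto simp: continuous_on_def)
    ultimately have "((\<lambda>y. w y * f y + (1 - w y) * h \<lfloor>M * x\<rfloor>) \<longlongrightarrow> g x) (at x within {0..1})"
      unfolding g_def by (intro tendsto_intros)
    then show ?thesis
      unfolding continuous_within by (simp add: tendsto_cong[OF ev])
  qed
  then have cont: "continuous_on {0..1} g"
    by (simp add: continuous_on_eq_continuous_within)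
  have near: "\<bar>g x - f x\<bar> \<le> \<delta>" if x: "x \<in> {0..1}" for x :: real
  proof -
    \<comment> \<open>The left end of the cell containing \<open>x\<close>. Passing from
      \<open>f x\<close> to \<open>f y\<close> and then rounding costs less than \<delta> in
      all.\<close>
    define y where "y = of_int \<lfloor>M * x\<rfloor> / real M"
    have fl: "of_int \<lfloor>M * x\<rfloor> \<le> M * x" "M * x < of_int \<lfloor>M * x\<rfloor> + 1"
      by linarith+
    have "0 \<le> \<lfloor>M * x\<rfloor>" using x by simp
    then have "0 \<le> y" by (simp add: y_def)
    have yx: "y \<le> x" "x < y + 1 / M"
      using fl M(2) by (auto simp: y_def field_simps)
    have "dist y x < \<eta>"
      using yx M(3) by (simp add: dist_real_def)
    then have fy: "\<bar>f y - f x\<bar> < \<delta> / 2"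
      using \<eta>(2)[of x y] x yx \<open>0 \<le> y\<close> by (auto simp: dist_real_def)
    have "\<bar>of_int (round (N * f y)) - N * f y\<bar> \<le> 1"
      using of_int_round_abs_le[of "N * f y"] by linarith
    then have "\<bar>of_int (round (N * f y)) - N * f y\<bar> / N \<le> 1 / N"
      using N(2) by (intro divide_right_mono) auto
    moreover have "\<bar>h \<lfloor>M * x\<rfloor> - f y\<bar> = \<bar>of_int (round (N * f y)) - N * f y\<bar> / N"
    proof -
      have "h \<lfloor>M * x\<rfloor> - f y = (of_int (round (N * f y)) - N * f y) / N"
        using N(2) by (simp add: h_def y_def field_simps)
      then show ?thesis by simp
    qed
    ultimately have "\<bar>h \<lfloor>M * x\<rfloor> - f y\<bar> \<le> 1 / N"
      by simp
    then have hy: "\<bar>h \<lfloor>M * x\<rfloor> - f x\<bar> \<le> \<delta>"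
      using fy N(3) by linarith
    \<comment> \<open>\<open>g x\<close> is a convex combination of \<open>f x\<close> and the
      rounded value, so it is no farther from \<open>f x\<close> than the latter.\<close>
    have "g x - f x = (1 - w x) * (h \<lfloor>M * x\<rfloor> - f x)"
      by (simp add: g_def algebra_simps)
    then have "\<bar>g x - f x\<bar> = (1 - w x) * \<bar>h \<lfloor>M * x\<rfloor> - f x\<bar>"
      using w[of x] by (simp add: abs_mult)
    also have "\<dots> \<le> 1 * \<delta>"
      using w[of x] hy by (intro mult_mono) auto
    finally show ?thesis by simp
  qed
  have "resonant c g M N"
    unfolding resonant_def
  proof
    fix x :: real assume "x \<in> {0..1}"
    show "norm (1 - cis (- 2 * pi * M * x)) * norm (1 - cis (- 2 * pi * N * g x)) \<le> c"
    \<comment> \<open>If \<open>p x\<close> is at least \<open>c / 2\<close>, the cutoff vanishes,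
      \<open>N * g x\<close> is an integer and the second factor is 0. Otherwise the trivial bound 2
      on the second factor suffices.\<close>
    proof (cases "c / 2 \<le> p x")
      case True
      then have "- 2 * pi * N * g x = 2 * pi * of_int (- round (N * f (of_int \<lfloor>M * x\<rfloor> / M)))"
        using N(2) by (simp add: g_def w0 h_def)
      then have "cis (- 2 * pi * N * g x) = 1"
        by (metis cis_multiple_2pi Ints_of_int)
      then show ?thesis using c by simp
    next
      case False
      have "norm (1 - cis (- 2 * pi * N * g x)) \<le> 2"
        using norm_triangle_ineq4[of 1 "cis (- 2 * pi * N * g x)"] by simp
      then have "p x * norm (1 - cis (- 2 * pi * N * g x)) \<le> (c / 2) * 2"
        using False c by (intro mult_mono) auto
      then show ?thesis by (simp add: p_def)
    qed
  qed
  then show ?thesis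
    using cont near N M by blast
qed

section \<open>Consequences for the limsup and the Fourier dimension\<close>

lemma Limsup_fourier_transform_ge:
  assumes \<mu>: "\<mu> \<in> borel_prob_measures_on (graph01 f)"
    and res: "\<And>n. \<exists>M\<ge>n. \<exists>N\<ge>n. resonant c f M N"
  shows "ereal ((1 - c) / 3) \<le> Limsup at_infinity (\<lambda>\<xi>. ereal (norm (fourier_transform \<mu> \<xi>)))"
proof (rule ccontr)
  assume "\<not> ?thesis"
  then have "\<forall>\<^sub>F \<xi> in at_infinity. ereal (norm (fourier_transform \<mu> \<xi>)) < ereal ((1 - c) / 3)"
    by (intro Limsup_lessD) simp
  then obtain b where b: "\<And>\<xi>. b \<le> norm \<xi> \<Longrightarrow> norm (fourier_transform \<mu> \<xi>) < (1 - c) / 3"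
    by (auto simp: eventually_at_infinity)
  obtain n :: nat where n: "b \<le> n" using real_arch_simple by blast
  obtain M N where MN: "M \<ge> n" "N \<ge> n" "resonant c f M N" using res by blast
  \<comment> \<open>Both \<open>M\<close> and \<open>N\<close> must be large here: two of the three
    frequencies lie on the coordinate axes.\<close>
  have "b \<le> norm (real M, 0::real)" "b \<le> norm (0::real, real N)"
    using MN n by (simp_all add: norm_Pair)
  moreover have "b \<le> norm (real M, real N)"
    using MN n norm_fst_le[of "real M" "real N"] by simp
  ultimately show False
    using resonant_fourier_transform_ge[OF \<mu> MN(3)] b[of "(M, 0)"] b[of "(0, N)"] b[of "(M, N)"]
    by simp
qed

text \<open>A decay rate with \<open>s > 0\<close> would force the transform to tend to 0 at
  infinity, against the positive limsup. Hence 0 is the only admissible exponent.\<close>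

lemma fourier_dim_eq_0:
  assumes "K \<noteq> {}" "closed K" and c: "c > 0"
    and lim: "\<And>\<mu>. \<mu> \<in> borel_prob_measures_on K \<Longrightarrow>
      ereal c \<le> Limsup at_infinity (\<lambda>\<xi>. ereal (norm (fourier_transform \<mu> \<xi>)))"
  shows "fourier_dim K = 0"
proof -
  let ?S = "{s. 0 \<le> s \<and> s \<le> 2 \<and>
     (\<exists>M\<in>borel_prob_measures_on K. \<exists>C>0. \<forall>\<xi>. \<xi> \<noteq> 0 \<longrightarrow>
        norm (fourier_transform M \<xi>) \<le> C * norm \<xi> powr (- s / 2))}"
  obtain a where a: "a \<in> K" using assms by blast
  \<comment> \<open>A point mass shows that 0 is admissible, so the supremum is not over the empty
    set. Its support stays in \<open>K\<close> because the complement of \<open>K\<close> is an open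
    null set.\<close>
  have "return borel a \<in> borel_prob_measures_on K"
  proof -
    have "spt (return borel a) \<subseteq> K"
    proof
      fix x assume x: "x \<in> spt (return borel a)"
      show "x \<in> K"
      proof (rule ccontr)
        assume "x \<notin> K"
        then have "emeasure (return borel a) (- K) > 0"
          using x assms(2) unfolding spt_def by (auto simp: open_Compl)
        then show False
          using a assms(2) by (simp add: emeasure_return)
      qed
    qed
    then show ?thesis
      by (auto simp: borel_prob_measures_on_def intro!: prob_space_return)
  qed
  moreover have "norm (fourier_transform (return borel a) \<xi>) \<le> 1" for \<xi>
  proof -
    have "fourier_transform (return borel a) \<xi>
        = exp (- 2 * complex_of_real pi * \<i> * complex_of_real (a \<bullet> \<xi>))"
      unfolding fourier_transform_def
      by (rule integral_return) (auto intro!: borel_measurable_continuous_onI continuous_intros)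
    then show ?thesis by simp
  qed
  ultimately have 0: "0 \<in> ?S"
    by (auto intro!: bexI[of _ "return borel a"] exI[of _ 1])
  have "s = 0" if s: "s \<in> ?S" for s
  proof (rule ccontr)
    assume "s \<noteq> 0"
    then have "s > 0" using s by simp
    from s obtain M C where M: "M \<in> borel_prob_measures_on K" and "C > 0"
      and le: "\<And>\<xi>. \<xi> \<noteq> 0 \<Longrightarrow> norm (fourier_transform M \<xi>) \<le> C * norm \<xi> powr (- s / 2)"
      by blast
    have "((\<lambda>\<xi>::real \<times> real. norm \<xi> powr (- s / 2)) \<longlongrightarrow> 0) at_infinity"
      using \<open>s > 0\<close> by (intro tendsto_neg_powr filterlim_norm_at_top) auto
    then have "((\<lambda>\<xi>::real \<times> real. C * norm \<xi> powr (- s / 2)) \<longlongrightarrow> C * 0) at_infinity"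
      by (intro tendsto_intros)
    then have ev: "eventually (\<lambda>\<xi>::real \<times> real. C * norm \<xi> powr (- s / 2) < c / 2) at_infinity"
      using c by (intro order_tendstoD(2)) auto
    have "eventually (\<lambda>\<xi>::real \<times> real. \<xi> \<noteq> 0) at_infinity"
      unfolding eventually_at_infinity by (intro exI[of _ 1]) auto
    with ev have "eventually (\<lambda>\<xi>. ereal (norm (fourier_transform M \<xi>)) \<le> ereal (c / 2)) at_infinity"
    proof eventually_elim
      case (elim \<xi>)
      then show ?case using le[of \<xi>] by simp
    qed
    then have "Limsup at_infinity (\<lambda>\<xi>. ereal (norm (fourier_transform M \<xi>))) \<le> ereal (c / 2)"
      by (rule Limsup_bounded)
    with lim[OF M] have "ereal c \<le> ereal (c / 2)" by (rule order_trans)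
    then show False using c by simp
  qed
  with 0 have "?S = {0}" by blast
  then show ?thesis by (simp add: fourier_dim_def)
qed

section \<open>Baire category\<close>

text \<open>Since \<open>meagre_in\<close> asks for equality with the union, each nowhere dense
  piece is cut down to \<open>T\<close>.\<close>

lemma meagre_in_subset:
  assumes "meagre_in X S" "T \<subseteq> S"
  shows "meagre_in X T"
proof -
  obtain \<F> where \<F>: "countable \<F>" "\<forall>A\<in>\<F>. nowhere_dense_in X A" "S = \<Union>\<F>"
    using assms(1) by (auto simp: meagre_in_def)
  have "nowhere_dense_in X (A \<inter> T)" if "A \<in> \<F>" for A
  proof -
    have "X interior_of (X closure_of (A \<inter> T)) \<subseteq> X interior_of (X closure_of A)"
      by (intro interior_of_mono closure_of_mono) auto
    then show ?thesis
      using \<F>(2) that unfolding nowhere_dense_in_def by blast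
  qed
  moreover have "T = \<Union>((\<lambda>A. A \<inter> T) ` \<F>)"
    using \<F>(3) assms(2) by blast
  ultimately show ?thesis
    using \<F>(1) unfolding meagre_in_def
    by (intro exI[of _ "(\<lambda>A. A \<inter> T) ` \<F>"]) auto
qed

lemma typical_in_mono:
  assumes "typical_in m P" "\<And>f. f \<in> mspace m \<Longrightarrow> P f \<Longrightarrow> Q f"
  shows "typical_in m Q"
proof -
  have "topspace (mtopology_of m) - {x \<in> mspace m. Q x}
      \<subseteq> topspace (mtopology_of m) - {x \<in> mspace m. P x}"
    using assms(2) by auto
  then show ?thesis
    using assms(1) meagre_in_subset unfolding typical_in_def residual_in_def by auto
qed

text \<open>The complement of a dense open set is closed with empty interior, hence nowhere
  dense.\<close>

lemma typical_in_open_dense: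
  assumes "\<And>n::nat. openin (mtopology_of m) (U n)"
    and "\<And>n. mtopology_of m closure_of U n = mspace m"
  shows "typical_in m (\<lambda>f. \<forall>n. f \<in> U n)"
proof -
  let ?X = "mtopology_of m"
  have "nowhere_dense_in ?X (mspace m - U n)" for n
  proof -
    have "closedin ?X (mspace m - U n)"
      using assms(1)[of n] by (metis closedin_diff closedin_topspace topspace_mtopology_of)
    then have "?X closure_of (mspace m - U n) = mspace m - U n"
      by (rule closure_of_closedin)
    moreover have "?X interior_of (mspace m - U n) = mspace m - ?X closure_of U n"
      by (metis interior_of_complement topspace_mtopology_of)
    ultimately show ?thesis
      using assms(2)[of n] by (simp add: nowhere_dense_in_def)
  qed
  moreover have "mspace m - {f \<in> mspace m. \<forall>n. f \<in> U n} = \<Union>(range (\<lambda>n. mspace m - U n))"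
    by auto
  ultimately show ?thesis
    unfolding typical_in_def residual_in_def meagre_in_def
    by (auto intro!: exI[of _ "range (\<lambda>n. mspace m - U n)"])
qed

section \<open>Typical functions are resonant at all scales\<close>

lemma abs_diff_le_mdist_C01:
  assumes "f \<in> mspace C01" "g \<in> mspace C01" "x \<in> {0..1}"
  shows "\<bar>f x - g x\<bar> \<le> mdist C01 f g"
proof -
  have "continuous_on {0..1} (\<lambda>x. \<bar>f x - g x\<bar>)"
    using assms by (intro continuous_intros) (auto simp: mspace_C01)
  then have "compact ((\<lambda>x. \<bar>f x - g x\<bar>) ` {0..1})"
    by (intro compact_continuous_image) auto
  then have "bdd_above ((\<lambda>x. \<bar>f x - g x\<bar>) ` {0..1})"
    by (intro bounded_imp_bdd_above compact_imp_bounded)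
  then show ?thesis
    unfolding mdist_C01[OF assms(1,2)] using assms(3) by (rule cSUP_upper2) auto
qed

text \<open>\<open>U n\<close> is a union of balls around functions resonant with constant
  \<open>c / 2\<close>. The balls are so small that their points are still resonant with constant
  \<open>c\<close>, for the same \<open>M\<close> and \<open>N\<close>.\<close>

lemma typical_resonant:
  assumes c: "c > 0"
  shows "typical_in C01 (\<lambda>f. \<forall>n. \<exists>M\<ge>n. \<exists>N\<ge>n. resonant c f M N)"
proof -
  \<comment> \<open>Chosen so that the perturbation loss \<open>4 * pi * N * r N\<close> is at most
    \<open>c / 2\<close>; the \<open>+ 1\<close> keeps the radius positive for
    \<open>N = 0\<close>.\<close>
  define r where "r N = c / (8 * pi * (real N + 1))" for N :: nat
  have r: "r N > 0" for N using c by (simp add: r_def)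
  define U where "U n = \<Union>{mball_of C01 g (r N) | g M N.
      g \<in> mspace C01 \<and> n \<le> M \<and> n \<le> N \<and> resonant (c / 2) g M N}" for n
  interpret C: Metric_space "mspace C01" "mdist C01" by (rule Metric_space_mspace_mdist)
  have top: "mtopology_of C01 = C.mtopology"
    by (simp add: mtopology_of_def)
  have ball: "mball_of C01 g e = C.mball g e" for g e
    by (simp add: mball_of_def)
  have "typical_in C01 (\<lambda>f. \<forall>n. f \<in> U n)"
  proof (rule typical_in_open_dense)
    fix n
    show "openin (mtopology_of C01) (U n)"
      unfolding U_def by (rule openin_Union) (auto simp: top ball)
    show "mtopology_of C01 closure_of U n = mspace C01"
    proof
      show "mtopology_of C01 closure_of U n \<subseteq> mspace C01"
        by (metis closure_of_subset_topspace topspace_mtopology_of)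
      show "mspace C01 \<subseteq> mtopology_of C01 closure_of U n"
      proof
        fix f assume f: "f \<in> mspace C01"
        have "\<exists>g\<in>U n. g \<in> C.mball f e" if "e > 0" for e
        proof -
          have "continuous_on {0..1} f" using f by (simp add: mspace_C01)
          then obtain g0 M N where g0: "continuous_on {0..1} g0"
            "\<forall>x\<in>{0..1}. \<bar>g0 x - f x\<bar> \<le> e / 2" "n \<le> M" "n \<le> N" "resonant (c / 2) g0 M N"
            using resonant_dense[of f "e / 2" "c / 2" n] \<open>e > 0\<close> c by (meson half_gt_zero)
          \<comment> \<open>Points of \<open>C01\<close> must be \<open>undefined\<close> outside
            the interval; restricting leaves resonance unchanged.\<close>
          define g where "g = restrict g0 {0..1}"
          have "continuous_on {0..1} g"
            using g0(1) by (rule continuous_on_eq) (simp add: g_def)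
          then have g: "g \<in> mspace C01"
            by (simp add: g_def mspace_C01)
          have res: "resonant (c / 2) g M N"
            using g0(5) by (simp add: resonant_def g_def)
          have "mdist C01 f g \<le> e / 2"
            unfolding mdist_C01[OF f g]
            using g0(2) by (intro cSUP_least) (auto simp: g_def abs_minus_commute)
          then have "g \<in> C.mball f e"
            using f g that by simp
          moreover have "g \<in> U n"
            unfolding U_def
            by (intro UnionI[of "mball_of C01 g (r N)"])
              (use g res g0(3,4) r[of N] in \<open>auto simp: ball\<close>)
          ultimately show ?thesis by blast
        qed
        then show "f \<in> mtopology_of C01 closure_of U n"
          using f by (simp add: top C.metric_closure_of)
      qed
    qed
  qed
  then show ?thesis
  proof (rule typical_in_mono)
    fix f assume f: "f \<in> mspace C01" and U: "\<forall>n. f \<in> U n"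
    show "\<forall>n. \<exists>M\<ge>n. \<exists>N\<ge>n. resonant c f M N"
    proof
      fix n
      obtain g M N where g: "g \<in> mspace C01" "n \<le> M" "n \<le> N" "resonant (c / 2) g M N"
        and fg: "f \<in> C.mball g (r N)"
        using U unfolding U_def ball by blast
      have "resonant (c / 2 + 4 * pi * N * r N) f M N"
      proof (rule resonant_perturb[OF g(4)])
        fix x :: real assume "x \<in> {0..1}"
        then have "\<bar>f x - g x\<bar> \<le> mdist C01 f g"
          using f g(1) by (intro abs_diff_le_mdist_C01)
        also have "\<dots> \<le> r N"
          using fg by (simp add: C.commute)
        finally show "\<bar>f x - g x\<bar> \<le> r N" .
      qed
      moreover have "4 * pi * N * r N \<le> c / 2"
      proof -
        have "4 * pi * N * r N = c / 2 * (N / (real N + 1))"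
          by (simp add: r_def divide_simps)
        also have "\<dots> \<le> c / 2 * 1"
          using c by (intro mult_left_mono) auto
        finally show ?thesis by simp
      qed
      ultimately have "resonant c f M N"
        unfolding resonant_def by fastforce
      then show "\<exists>M\<ge>n. \<exists>N\<ge>n. resonant c f M N"
        using g by blast
    qed
  qed
qed

theorem theorem1p2:
  shows "typical_in C01 (\<lambda>f. \<forall>\<mu> \<in> borel_prob_measures_on (graph01 f).
           Limsup at_infinity (\<lambda>\<xi>. ereal (norm (fourier_transform \<mu> \<xi>))) \<ge> ereal (1 / 5))
       \<and> typical_in C01 (\<lambda>f. fourier_dim (graph01 f) = 0)"
proof
  show lim: "typical_in C01 (\<lambda>f. \<forall>\<mu> \<in> borel_prob_measures_on (graph01 f).
           Limsup at_infinity (\<lambda>\<xi>. ereal (norm (fourier_transform \<mu> \<xi>))) \<ge> ereal (1 / 5))"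
    using typical_resonant[of "2 / 5"]
  proof (rule typical_in_mono)
    fix f :: "real \<Rightarrow> real" assume "\<forall>n. \<exists>M\<ge>n. \<exists>N\<ge>n. resonant (2 / 5) f M N"
    then show "\<forall>\<mu> \<in> borel_prob_measures_on (graph01 f).
           Limsup at_infinity (\<lambda>\<xi>. ereal (norm (fourier_transform \<mu> \<xi>))) \<ge> ereal (1 / 5)"
      using Limsup_fourier_transform_ge[of _ f "2 / 5"] by simp
  qed simp
  show "typical_in C01 (\<lambda>f. fourier_dim (graph01 f) = 0)"
    using lim
  proof (rule typical_in_mono)
    fix f assume "f \<in> mspace C01"
    \<comment> \<open>The graph is a continuous image of a compact interval, hence closed and
      nonempty.\<close>
    then have "continuous_on {0..1} (\<lambda>x. (x, f x))"
      by (intro continuous_intros) (simp add: mspace_C01)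
    then have "compact ((\<lambda>x. (x, f x)) ` {0..1})"
      by (intro compact_continuous_image) auto
    moreover have "graph01 f = (\<lambda>x. (x, f x)) ` {0..1}"
      by (auto simp: graph01_def)
    ultimately have "closed (graph01 f)" "graph01 f \<noteq> {}"
      by (auto intro: compact_imp_closed)
    moreover assume "\<forall>\<mu> \<in> borel_prob_measures_on (graph01 f).
           Limsup at_infinity (\<lambda>\<xi>. ereal (norm (fourier_transform \<mu> \<xi>))) \<ge> ereal (1 / 5)"
    ultimately show "fourier_dim (graph01 f) = 0"
      by (intro fourier_dim_eq_0[of _ "1 / 5"]) auto
  qed
qed

end
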